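(* Let $s\geq 0$, $k\geq s+1$ be integers and $n\geq 2k+1$. Let $G$ be a connected simple graph of order $n$ with minimum degree $\delta(G)\geq k$. If $$\mu(\overline{G})\leq \sqrt{(k-s)(n-k-1)},$$ then $G$ is $s$-Hamiltonian unless $G\in EP_n$ or $G\in ES_n$.
   Context: For a simple graph $H$, $\overline{H}$ denotes its complement and $\mu(H)$ denotes the spectral radius (largest eigenvalue) of the adjacency matrix of $H$. For disjoint graphs $G_1,G_2$, the join $G_1\vee G_2$ is the graph on $V(G_1)\cup V(G_2)$ whose edges are those of $G_1$, those of $G_2$, and all edges $xy$ with $x\in V(G_1)$, $y\in V(G_2)$. $K_m$ is the complete graph on $m$ vertices. A graph is semi-regular bipartite if it is bipartite and vertices in the same part have the same degree. A graph $G$ is $s$-Hamiltonian if for every $X\subset V(G)$ with $|X|\leq s$, the subgraph induced by $V(G)\setminus X$ is Hamiltonian. $EP_n$ (depending on $n$ and $k$) is the set of graphs of order $n$ of the form $G_1\vee G_2$, where, for some integer $r$ with $0\le r\le k$, $G_1$ is an $r$-regular graph of order $n-k+r$ and $G_2$ is a spanning subgraph of $K_{k-r}$. $ES_n$ (depending on $n,k,s$) is the set of graphs of order $n$ of the form $\overline{G_1}\vee G_2$, where, for some integer $r$ with $s+1-r\geq 0$, $G_1$ is a semi-regular bipartite graph of order $n-s-1+r$ with parts $X,Y$ such that every $u\in X$ has $d_{G_1}(u)=k-s$ and every $v\in Y$ has $d_{G_1}(v)=n-k-1$, and $G_2$ is a graph with $|V(G_2)|=s+1-r$. *)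

theory Defs
  imports "Graph_Theory.Graph_Theory" "Jordan_Normal_Form.Spectral_Radius"
begin

text \<open>
  A finite simple graph is a \<^locale>\<open>pair_graph\<close>: an edge \<open>xy\<close> is represented by the two
  arcs \<open>(x, y)\<close> and \<open>(y, x)\<close>. The degree of a vertex is therefore its \<^const>\<open>out_degree\<close>.
\<close>

abbreviation graph_order :: "'a pair_pre_digraph \<Rightarrow> nat" where
  "graph_order G \<equiv> card (pverts G)"

definition min_degree :: "'a pair_pre_digraph \<Rightarrow> nat" where
  "min_degree G = Min (out_degree (with_proj G) ` pverts G)"

definition regular_graph :: "nat \<Rightarrow> 'a pair_pre_digraph \<Rightarrow> bool" where
  "regular_graph r G \<longleftrightarrow> (\<forall>v \<in> pverts G. out_degree (with_proj G) v = r)"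

definition graph_complement :: "'a pair_pre_digraph \<Rightarrow> 'a pair_pre_digraph" where
  "graph_complement G = \<lparr> pverts = pverts G,
     parcs = {(u, v). u \<in> pverts G \<and> v \<in> pverts G \<and> u \<noteq> v \<and> (u, v) \<notin> parcs G} \<rparr>"

definition graph_join :: "'a pair_pre_digraph \<Rightarrow> 'a pair_pre_digraph \<Rightarrow> 'a pair_pre_digraph" where
  "graph_join G H = \<lparr> pverts = pverts G \<union> pverts H,
     parcs = parcs G \<union> parcs H \<union> pverts G \<times> pverts H \<union> pverts H \<times> pverts G \<rparr>"

definition bipartition :: "'a pair_pre_digraph \<Rightarrow> 'a set \<Rightarrow> 'a set \<Rightarrow> bool" where
  "bipartition G X Y \<longleftrightarrow> pverts G = X \<union> Y \<and> X \<inter> Y = {} \<and> parcs G \<subseteq> X \<times> Y \<union> Y \<times> X"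

definition semi_regular_bipartite :: "'a pair_pre_digraph \<Rightarrow> 'a set \<Rightarrow> 'a set \<Rightarrow> bool" where
  "semi_regular_bipartite G X Y \<longleftrightarrow> bipartition G X Y \<and>
     (\<forall>u \<in> X. \<forall>v \<in> X. out_degree (with_proj G) u = out_degree (with_proj G) v) \<and>
     (\<forall>u \<in> Y. \<forall>v \<in> Y. out_degree (with_proj G) u = out_degree (with_proj G) v)"

text \<open>
  In a symmetric digraph the closed walk along \<open>(x, y)\<close> and \<open>(y, x)\<close> is a
  \<^const>\<open>pre_digraph.cycle\<close>; the length condition excludes it.
\<close>

definition hamiltonian :: "('a, 'b) pre_digraph \<Rightarrow> bool" where
  "hamiltonian G \<longleftrightarrow> (\<exists>p. pre_digraph.cycle G p \<and> 3 \<le> length p \<and> tail G ` set p = verts G)"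

definition s_hamiltonian :: "nat \<Rightarrow> 'a pair_pre_digraph \<Rightarrow> bool" where
  "s_hamiltonian s G \<longleftrightarrow>
     (\<forall>X \<subseteq> pverts G. card X \<le> s \<longrightarrow> hamiltonian (with_proj G \<restriction> (pverts G - X)))"

definition adjacency_matrix :: "'a list \<Rightarrow> 'a pair_pre_digraph \<Rightarrow> complex mat" where
  "adjacency_matrix vs G =
     mat (length vs) (length vs) (\<lambda>(i, j). if (vs ! i, vs ! j) \<in> parcs G then 1 else 0)"

text \<open>
  The choice of the enumeration of the vertices is immaterial, see
  \<open>graph_spectral_radius_eq\<close> below.
\<close>

definition graph_spectral_radius :: "'a pair_pre_digraph \<Rightarrow> real" where
  "graph_spectral_radius G =
     spectral_radius (adjacency_matrix (SOME vs. distinct vs \<and> set vs = pverts G) G)"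

lemma spectrum_adjacency_matrix:
  assumes "distinct vs"
  shows "spectrum (adjacency_matrix vs G) =
    {c. \<exists>f. (\<exists>v \<in> set vs. f v \<noteq> 0) \<and>
       (\<forall>u \<in> set vs. (\<Sum>v \<in> set vs. (if (u, v) \<in> parcs G then f v else 0)) = c * f u)}"
proof -
  let ?n = "length vs" and ?A = "adjacency_matrix vs G"
  have A: "?A \<in> carrier_mat ?n ?n" by (simp add: adjacency_matrix_def)
  have row: "(?A *\<^sub>v vec ?n (\<lambda>i. f (vs ! i))) $ i =
      (\<Sum>v \<in> set vs. (if (vs ! i, v) \<in> parcs G then f v else 0))"
    if "i < ?n" for i and f :: "'a \<Rightarrow> complex"
  proof -
    have "(?A *\<^sub>v vec ?n (\<lambda>i. f (vs ! i))) $ i =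
        (\<Sum>j = 0..<?n. (if (vs ! i, vs ! j) \<in> parcs G then f (vs ! j) else 0))"
      using that by (auto simp: adjacency_matrix_def scalar_prod_def intro!: sum.cong)
    also have "\<dots> = (\<Sum>v \<in> set vs. (if (vs ! i, v) \<in> parcs G then f v else 0))"
      using bij_betw_nth[OF assms refl refl]
      by (intro sum.reindex_bij_betw) (simp add: atLeast0LessThan)
    finally show ?thesis .
  qed
  have ev: "eigenvector ?A (vec ?n (\<lambda>i. f (vs ! i))) c \<longleftrightarrow>
      (\<exists>v \<in> set vs. f v \<noteq> 0) \<and>
      (\<forall>u \<in> set vs. (\<Sum>v \<in> set vs. (if (u, v) \<in> parcs G then f v else 0)) = c * f u)"
    for f :: "'a \<Rightarrow> complex" and c
  proof -
    have "vec ?n (\<lambda>i. f (vs ! i)) \<noteq> 0\<^sub>v ?n \<longleftrightarrow> (\<exists>v \<in> set vs. f v \<noteq> 0)"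
      by (force simp: vec_eq_iff in_set_conv_nth)
    moreover have "?A *\<^sub>v vec ?n (\<lambda>i. f (vs ! i)) = c \<cdot>\<^sub>v vec ?n (\<lambda>i. f (vs ! i)) \<longleftrightarrow>
        (\<forall>i < ?n. (\<Sum>v \<in> set vs. (if (vs ! i, v) \<in> parcs G then f v else 0)) = c * f (vs ! i))"
      using A by (auto simp: vec_eq_iff row simp del: index_mult_mat_vec)
    ultimately show ?thesis
      using A by (auto simp: eigenvector_def all_set_conv_all_nth)
  qed
  have "eigenvalue ?A c \<longleftrightarrow> (\<exists>f. eigenvector ?A (vec ?n (\<lambda>i. f (vs ! i))) c)" for c
  proof
    assume "eigenvalue ?A c"
    then obtain w where w: "eigenvector ?A w c" by (auto simp: eigenvalue_def)
    then have "dim_vec w = ?n" using A by (auto simp: eigenvector_def)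
    moreover define f where "f = (\<lambda>v. w $ (the_inv_into {..<?n} ((!) vs) v))"
    have "f (vs ! i) = w $ i" if "i < ?n" for i
      using that assms unfolding f_def
      by (subst the_inv_into_f_f) (auto simp: inj_on_def nth_eq_iff_index_eq)
    ultimately have "vec ?n (\<lambda>i. f (vs ! i)) = w" by auto
    with w show "\<exists>f. eigenvector ?A (vec ?n (\<lambda>i. f (vs ! i))) c" by metis
  qed (auto simp: eigenvalue_def)
  then show ?thesis by (auto simp: spectrum_def ev)
qed

lemma graph_spectral_radius_eq:
  assumes "distinct vs" "set vs = pverts G"
  shows "graph_spectral_radius G = spectral_radius (adjacency_matrix vs G)"
proof -
  let ?ws = "SOME vs. distinct vs \<and> set vs = pverts G"
  have "distinct ?ws \<and> set ?ws = pverts G" by (rule someI) (use assms in blast)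
  then have "spectrum (adjacency_matrix ?ws G) = spectrum (adjacency_matrix vs G)"
    using assms by (simp add: spectrum_adjacency_matrix)
  then show ?thesis by (simp add: graph_spectral_radius_def spectral_radius_def)
qed

definition EP :: "nat \<Rightarrow> nat \<Rightarrow> 'a pair_pre_digraph set" where
  "EP n k = {G. graph_order G = n \<and> (\<exists>r G\<^sub>1 G\<^sub>2 K.
     r \<le> k \<and> pair_graph G\<^sub>1 \<and> pair_graph G\<^sub>2 \<and> pverts G\<^sub>1 \<inter> pverts G\<^sub>2 = {} \<and>
     regular_graph r G\<^sub>1 \<and> int (graph_order G\<^sub>1) = int n - int k + int r \<and>
     complete_digraph (k - r) (with_proj K) \<and> spanning (with_proj G\<^sub>2) (with_proj K) \<and>
     G = graph_join G\<^sub>1 G\<^sub>2)}"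

text \<open>
  In \<open>ES\<close> the graph \<open>G\<^sub>1\<close> has at least one vertex. Since \<open>r\<close> may be negative, every graph
  of order \<open>n\<close> would otherwise be the join of the null graph (with \<open>r = s + 1 - n\<close>) and
  itself. The graph \<open>G\<^sub>2\<close>, by contrast, is null for \<open>r = s + 1\<close>.
\<close>

definition ES :: "nat \<Rightarrow> nat \<Rightarrow> nat \<Rightarrow> 'a pair_pre_digraph set" where
  "ES n k s = {G. graph_order G = n \<and> (\<exists>(r :: int) G\<^sub>1 G\<^sub>2 X Y.
     int s + 1 - r \<ge> 0 \<and> pair_graph G\<^sub>1 \<and> pair_graph G\<^sub>2 \<and> pverts G\<^sub>1 \<inter> pverts G\<^sub>2 = {} \<and>
     pverts G\<^sub>1 \<noteq> {} \<and> int (graph_order G\<^sub>1) = int n - int s - 1 + r \<and>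
     semi_regular_bipartite G\<^sub>1 X Y \<and>
     (\<forall>u \<in> X. int (out_degree (with_proj G\<^sub>1) u) = int k - int s) \<and>
     (\<forall>v \<in> Y. int (out_degree (with_proj G\<^sub>1) v) = int n - int k - 1) \<and>
     int (graph_order G\<^sub>2) = int s + 1 - r \<and>
     G = graph_join (graph_complement G\<^sub>1) G\<^sub>2)}"

end

theory Submission
  imports "HOL-Analysis.Function_Topology" Defs
begin

text \<open>
  Suppose that \<open>G - X\<close> is not Hamiltonian for some \<open>|X| \<le> s\<close>, and let \<open>H\<close> be an edge-maximal
  non-Hamiltonian graph containing it. Ore's argument bounds the degree sums of non-adjacent
  vertices of \<open>H\<close>; so in the complement \<open>F\<close> of \<open>H\<close>, which is a subgraph of the complement of
  \<open>G\<close>, adjacent vertices have degrees at most \<open>b = n - k - 1\<close> and of sum at least \<open>a + b\<close>, where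
  \<open>a = k - s\<close>. The product of these degrees is therefore at least \<open>a b\<close>. The Rayleigh quotient of
  the vector \<open>u \<mapsto> sqrt (d u)\<close>, where \<open>d\<close> is the degree in \<open>F\<close>, then shows that the spectral
  radius of the complement of \<open>G\<close> is at least \<open>sqrt (a b)\<close>. By hypothesis equality holds
  throughout: the vector is an eigenvector, the non-isolated vertices of \<open>F\<close> span a union of
  components of the complement of \<open>G\<close> that has no edges outside \<open>F\<close>, and every edge of \<open>F\<close>
  joins a vertex of degree \<open>a\<close> to one of degree \<open>b\<close>. If \<open>a = b\<close>, then \<open>s = 0\<close>, \<open>n = 2 k + 1\<close> and
  \<open>G\<close> is in \<open>EP\<close>; otherwise \<open>G\<close> is in \<open>ES\<close>.
\<close>

section \<open>Rayleigh quotients and the spectral radius\<close>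

definition quadratic_form :: "'a set \<Rightarrow> ('a \<Rightarrow> 'a \<Rightarrow> real) \<Rightarrow> ('a \<Rightarrow> real) \<Rightarrow> real" where
  "quadratic_form V a x = (\<Sum>u\<in>V. \<Sum>v\<in>V. a u v * (x u * x v))"

text \<open>The form is continuous on the compact unit sphere, and homogeneity of degree two carries
  the bound over to every \<open>y\<close>.\<close>

lemma quadratic_form_attains_max:
  assumes "finite V" "V \<noteq> {}"
  obtains x where "(\<Sum>v\<in>V. (x v)\<^sup>2) = 1"
    and "\<And>y. quadratic_form V a y \<le> quadratic_form V a x * (\<Sum>v\<in>V. (y v)\<^sup>2)"
proof -
  \<comment> \<open>Coordinates outside \<open>V\<close> are pinned to 0, so the box is a product of
    compact sets, and Tychonoff's theorem applies in the full function space.\<close>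
  define box where "box = Pi\<^sub>E UNIV (\<lambda>v. if v \<in> V then {- 1..1 :: real} else {0})"
  define sphere where "sphere = box \<inter> {x. (\<Sum>v\<in>V. (x v)\<^sup>2) = 1}"
  have "compactin (product_topology (\<lambda>_. euclidean) UNIV) box"
    unfolding box_def compactin_PiE by (auto simp: compactin_euclidean_iff)
  then have "compact box"
    by (simp add: euclidean_product_topology flip: compactin_euclidean_iff)
  moreover have "closed {x :: 'a \<Rightarrow> real. (\<Sum>v\<in>V. (x v)\<^sup>2) = 1}"
    by (intro closed_Collect_eq continuous_intros continuous_on_product_coordinates)
  ultimately have "compact sphere"
    unfolding sphere_def by (rule compact_Int_closed)
  moreover have "sphere \<noteq> {}"
  proof -
    obtain w where "w \<in> V" using assms by blast
    then have "(\<lambda>v. if v = w then 1 else 0) \<in> sphere"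
      using assms by (auto simp: sphere_def box_def PiE_UNIV_domain if_distrib[of "\<lambda>t. t\<^sup>2"]
          cong: if_cong)
    then show ?thesis by blast
  qed
  moreover have "continuous_on sphere (quadratic_form V a)"
    unfolding quadratic_form_def
    by (intro continuous_intros continuous_on_subset[OF continuous_on_product_coordinates]) auto
  ultimately obtain x where x: "x \<in> sphere"
    and max: "\<And>y. y \<in> sphere \<Longrightarrow> quadratic_form V a y \<le> quadratic_form V a x"
    by (metis continuous_attains_sup)
  have "quadratic_form V a y \<le> quadratic_form V a x * (\<Sum>v\<in>V. (y v)\<^sup>2)" for y
  proof (cases "(\<Sum>v\<in>V. (y v)\<^sup>2) = 0")
    case True
    then have "\<forall>v\<in>V. y v = 0"
      using assms by (simp add: sum_nonneg_eq_0_iff)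
    then show ?thesis
      using True by (simp add: quadratic_form_def)
  next
    case False
    define N where "N = (\<Sum>v\<in>V. (y v)\<^sup>2)"
    have "N > 0"
      using False sum_nonneg[of V "\<lambda>v. (y v)\<^sup>2"] by (auto simp: N_def less_le)
    define z where "z = (\<lambda>v. if v \<in> V then y v / sqrt N else 0)"
    have "(\<Sum>v\<in>V. (z v)\<^sup>2) = 1"
      using \<open>N > 0\<close> by (simp add: z_def power_divide N_def flip: sum_divide_distrib)
    moreover have "z v \<in> {- 1..1}" if "v \<in> V" for v
    proof -
      have "(z v)\<^sup>2 \<le> (\<Sum>v\<in>V. (z v)\<^sup>2)"
        using assms that by (intro member_le_sum) auto
      then show ?thesis
        using calculation by (simp add: abs_square_le_1 abs_le_iff)
    qed
    ultimately have "z \<in> sphere"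
      by (auto simp: sphere_def box_def z_def)
    moreover have "quadratic_form V a z = quadratic_form V a y / N"
      using \<open>N > 0\<close>
      by (simp add: quadratic_form_def z_def sum_divide_distrib cong: sum.cong)
    ultimately have "quadratic_form V a y / N \<le> quadratic_form V a x"
      using max by metis
    then show ?thesis
      using \<open>N > 0\<close> by (simp add: N_def pos_divide_le_eq)
  qed
  then show thesis
    using that x by (auto simp: sphere_def)
qed

text \<open>The eigenvalue equation at \<open>u\<close> is the first-order condition for changing
  the maximizer in the single coordinate \<open>u\<close>.\<close>

lemma quadratic_form_maximizer_eigenvector:
  assumes "finite V" and sym: "\<And>u v. a u v = a v u"
    and bound: "\<And>y. quadratic_form V a y \<le> c * (\<Sum>v\<in>V. (y v)\<^sup>2)"
    and eq: "quadratic_form V a x = c * (\<Sum>v\<in>V. (x v)\<^sup>2)"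
    and u: "u \<in> V"
  shows "(\<Sum>v\<in>V. a u v * x v) = c * x u"
proof -
  \<comment> \<open>Adding \<open>t\<close> to coordinate \<open>u\<close> changes the form minus
    \<open>c\<close> times the squared norm by \<open>2 * t * g + t\<^sup>2 * d\<close>.\<close>
  define g where "g = (\<Sum>v\<in>V. a u v * x v) - c * x u"
  define d where "d = a u u - c"
  have le: "2 * t * g + t\<^sup>2 * d \<le> 0" for t
  proof -
    define e where "e = (\<lambda>v. if v = u then t else 0)"
    have e1: "(\<Sum>v\<in>V. f v * e v) = f u * t" for f
      using assms(1) u by (simp add: e_def if_distrib[of "\<lambda>t. _ * t"] cong: if_cong)
    have "quadratic_form V a (\<lambda>v. x v + e v) =
        quadratic_form V a x + (\<Sum>v\<in>V. (\<Sum>w\<in>V. a v w * x w) * e v)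
        + (\<Sum>v\<in>V. x v * (\<Sum>w\<in>V. a v w * e w)) + (\<Sum>v\<in>V. (\<Sum>w\<in>V. a v w * e w) * e v)"
      unfolding quadratic_form_def sum_distrib_left sum_distrib_right sum.distrib[symmetric]
      by (intro sum.cong refl) (simp add: algebra_simps)
    also have "(\<Sum>v\<in>V. x v * (\<Sum>w\<in>V. a v w * e w)) = t * (\<Sum>v\<in>V. a u v * x v)"
      unfolding e1 sum_distrib_left
    proof (intro sum.cong refl)
      fix v
      show "x v * (a v u * t) = t * (a u v * x v)" using sym[of v u] by simp
    qed
    finally have 1: "quadratic_form V a (\<lambda>v. x v + e v) =
        quadratic_form V a x + 2 * t * (\<Sum>v\<in>V. a u v * x v) + t\<^sup>2 * a u u"
      unfolding e1 by (simp add: power2_eq_square)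
    have "(\<Sum>v\<in>V. (x v + e v)\<^sup>2) = (\<Sum>v\<in>V. (x v)\<^sup>2) + 2 * (\<Sum>v\<in>V. x v * e v) + (\<Sum>v\<in>V. e v * e v)"
      by (simp add: power2_eq_square algebra_simps sum.distrib sum_distrib_left)
    then have 2: "(\<Sum>v\<in>V. (x v + e v)\<^sup>2) = (\<Sum>v\<in>V. (x v)\<^sup>2) + 2 * t * x u + t\<^sup>2"
      using e1[of x] e1[of e] by (simp add: e_def power2_eq_square)
    show ?thesis
      using bound[of "\<lambda>v. x v + e v"] eq unfolding 1 2 g_def d_def by (simp add: algebra_simps)
  qed
  \<comment> \<open>At \<open>t = g / D\<close> the change is a positive multiple of
    \<open>g\<^sup>2\<close>, because \<open>D\<close> is chosen to make \<open>2 * D + d\<close>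
    positive. As it is at most 0, \<open>g\<close> vanishes.\<close>
  define D where "D = \<bar>d\<bar> + 1"
  have "D > 0" "2 * D + d > 0" by (auto simp: D_def)
  have "2 * (g / D) * g + (g / D)\<^sup>2 * d = g\<^sup>2 * (2 * D + d) / D\<^sup>2"
    using \<open>D > 0\<close> by (simp add: field_simps power2_eq_square)
  then have "g\<^sup>2 * (2 * D + d) / D\<^sup>2 \<le> 0"
    using le by metis
  then have "g = 0"
    using \<open>D > 0\<close> \<open>2 * D + d > 0\<close> by (auto simp: divide_le_0_iff mult_le_0_iff)
  then show ?thesis by (simp add: g_def)
qed

text \<open>The maximum of the Rayleigh quotient is an eigenvalue of the adjacency matrix, so its
  modulus is at most the spectral radius.\<close>

lemma quadratic_form_le_spectral_radius:
  assumes "finite (pverts G)" and sym: "sym (parcs G)"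
  shows "quadratic_form (pverts G) (\<lambda>u v. of_bool ((u, v) \<in> parcs G)) y
    \<le> graph_spectral_radius G * (\<Sum>v\<in>pverts G. (y v)\<^sup>2)"
proof (cases "pverts G = {}")
  case True
  then show ?thesis by (simp add: quadratic_form_def)
next
  case False
  let ?V = "pverts G"
  let ?a = "\<lambda>u v. of_bool ((u, v) \<in> parcs G) :: real"
  obtain x where norm: "(\<Sum>v\<in>?V. (x v)\<^sup>2) = 1"
    and max: "\<And>y. quadratic_form ?V ?a y \<le> quadratic_form ?V ?a x * (\<Sum>v\<in>?V. (y v)\<^sup>2)"
    using quadratic_form_attains_max[OF assms(1) False, of ?a] by blast
  define c where "c = quadratic_form ?V ?a x"
  have ev: "(\<Sum>v\<in>?V. ?a u v * x v) = c * x u" if "u \<in> ?V" for u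
    using sym that norm max assms(1)
    by (intro quadratic_form_maximizer_eigenvector) (auto simp: c_def dest: symD)
  obtain vs where vs: "distinct vs" "set vs = ?V"
    using finite_distinct_list[OF assms(1)] by blast
  define f where "f = (\<lambda>v. complex_of_real (x v))"
  have "(\<Sum>v\<in>?V. if (u, v) \<in> parcs G then f v else 0) = complex_of_real c * f u"
    if "u \<in> ?V" for u
  proof -
    have "(\<Sum>v\<in>?V. if (u, v) \<in> parcs G then f v else 0) = of_real (\<Sum>v\<in>?V. ?a u v * x v)"
      unfolding of_real_sum by (intro sum.cong refl) (simp add: f_def)
    then show ?thesis using ev[OF that] by (simp add: f_def)
  qed
  moreover have "\<exists>v\<in>?V. f v \<noteq> 0"
  proof (rule ccontr)
    assume "\<not> ?thesis"
    then have "(\<Sum>v\<in>?V. (x v)\<^sup>2) = 0" by (simp add: f_def)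
    then show False using norm by simp
  qed
  ultimately have "complex_of_real c \<in> spectrum (adjacency_matrix vs G)"
    unfolding spectrum_adjacency_matrix[OF vs(1)] vs(2) by blast
  then have "cmod (complex_of_real c) \<in> cmod ` spectrum (adjacency_matrix vs G)"
    by (rule imageI)
  moreover have "adjacency_matrix vs G \<in> carrier_mat (length vs) (length vs)"
    by (simp add: adjacency_matrix_def)
  moreover have "0 < length vs" using vs(2) False by auto
  ultimately have "cmod (complex_of_real c) \<le> graph_spectral_radius G"
    unfolding graph_spectral_radius_eq[OF vs] using spectral_radius_mem_max(2) by blast
  then have "c \<le> graph_spectral_radius G" by simp
  then have "c * (\<Sum>v\<in>?V. (y v)\<^sup>2) \<le> graph_spectral_radius G * (\<Sum>v\<in>?V. (y v)\<^sup>2)"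
    by (intro mult_right_mono sum_nonneg) auto
  then show ?thesis using max[of y] by (simp add: c_def)
qed

text \<open>
  The test vector \<open>x u = sqrt (d u)\<close> gives every edge of \<open>F\<close> weight at least \<open>c\<close>, while the squared
  norm of \<open>x\<close> is the number of arcs of \<open>F\<close>; hence its Rayleigh quotient is at least \<open>c\<close>, and every
  estimate on the way is an equality.
\<close>

lemma quadratic_form_edge_degrees_equality:
  fixes A F :: "'a rel" and c :: real
  defines "d \<equiv> \<lambda>u. card (F `` {u})"
  assumes "finite V" "A \<subseteq> V \<times> V" "sym A" "F \<subseteq> A" "c \<ge> 0"
    and bound: "\<And>y. quadratic_form V (\<lambda>u v. of_bool ((u, v) \<in> A)) y \<le> c * (\<Sum>v\<in>V. (y v)\<^sup>2)"
    and deg: "\<And>u v. (u, v) \<in> F \<Longrightarrow> c\<^sup>2 \<le> real (d u * d v)"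
  shows "(u, v) \<in> F \<Longrightarrow> real (d u * d v) = c\<^sup>2"
    and "(u, v) \<in> A \<Longrightarrow> d u > 0 \<Longrightarrow> (u, v) \<in> F"
proof -
  define x where "x = (\<lambda>u. sqrt (real (d u)))"
  have finA: "finite A"
    using assms(2,3) by (meson finite_SigmaI finite_subset)
  have finF: "finite F"
    using finA assms(5) by (rule rev_finite_subset)
  have form: "quadratic_form V (\<lambda>u v. of_bool ((u, v) \<in> A)) x = (\<Sum>(u, v)\<in>A. x u * x v)"
  proof -
    have "(\<Sum>(u, v)\<in>A. x u * x v) = (\<Sum>(u, v)\<in>V \<times> V. of_bool ((u, v) \<in> A) * (x u * x v))"
      using assms(2,3) by (intro sum.mono_neutral_cong_left) auto
    then show ?thesis
      by (simp add: quadratic_form_def sum.cartesian_product)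
  qed
  \<comment> \<open>Counting the arcs of \<open>F\<close> by their tails shows that the squared norm
    of \<open>x\<close> is \<open>card F\<close>.\<close>
  have "F = Sigma V (\<lambda>u. F `` {u})"
    using assms(3,5) by auto
  then have "card F = card (Sigma V (\<lambda>u. F `` {u}))"
    by (rule arg_cong)
  also have "\<dots> = (\<Sum>u\<in>V. d u)"
    unfolding d_def using assms(2) finF by (intro card_SigmaI) (auto intro: finite_Image)
  finally have "card F = (\<Sum>u\<in>V. d u)" .
  then have norm: "(\<Sum>v\<in>V. (x v)\<^sup>2) = real (card F)"
    by (simp add: x_def)
  have ge_F: "c \<le> x u * x v" if "(u, v) \<in> F" for u v
    using deg[OF that] real_le_rsqrt by (simp add: x_def flip: real_sqrt_mult)
  \<comment> \<open>\<open>g\<close> is the slack of each arc: arcs of \<open>F\<close> are compared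
    with \<open>c\<close>, the other arcs of \<open>A\<close> with 0. The bound on the form forces
    the total slack to be 0.\<close>
  define g where "g = (\<lambda>(u, v). x u * x v - c * of_bool ((u, v) \<in> F))"
  have g_nonneg: "g p \<ge> 0" for p
    using ge_F by (cases p) (auto simp: g_def x_def)
  have sum_g: "(\<Sum>p\<in>A. g p) = (\<Sum>(u, v)\<in>A. x u * x v) - c * real (card F)"
  proof -
    have "(\<Sum>p\<in>A. c * of_bool (p \<in> F)) = c * real (card F)"
      using finA assms(5) by (simp add: Int_absorb1 flip: sum_distrib_left)
    then show ?thesis
      by (simp add: g_def case_prod_unfold sum_subtractf)
  qed
  have "(\<Sum>p\<in>A. g p) \<le> 0"
    using bound[of x] form norm sum_g by simp
  then have sum0: "(\<Sum>p\<in>A. g p) = 0"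
    using sum_nonneg[of A g] g_nonneg by fastforce
  then have g0: "g p = 0" if "p \<in> A" for p
    using that finA g_nonneg by (simp add: sum_nonneg_eq_0_iff)
  show "real (d u * d v) = c\<^sup>2" if "(u, v) \<in> F" for u v
  proof -
    have "sqrt (real (d u * d v)) = c"
      using g0[of "(u, v)"] that assms(5) by (auto simp: g_def x_def real_sqrt_mult)
    then show ?thesis by auto
  qed
  have eigen: "(\<Sum>v\<in>V. of_bool ((u, v) \<in> A) * x v) = c * x u" if "u \<in> V" for u
  proof (rule quadratic_form_maximizer_eigenvector[where a = "\<lambda>u v. of_bool ((u, v) \<in> A)"])
    show "quadratic_form V (\<lambda>u v. of_bool ((u, v) \<in> A)) x = c * (\<Sum>v\<in>V. (x v)\<^sup>2)"
      using sum0 sum_g form norm by simp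
  qed (use assms that bound in \<open>auto dest: symD\<close>)
  \<comment> \<open>An arc outside \<open>F\<close> has slack \<open>x u * x v = 0\<close>, hence
    \<open>x v = 0\<close>. The eigenvalue equation at \<open>v\<close> is then a vanishing sum of
    nonnegative terms, one of which is \<open>x u > 0\<close>.\<close>
  show "(u, v) \<in> F" if "(u, v) \<in> A" "d u > 0" for u v
  proof (rule ccontr)
    assume "(u, v) \<notin> F"
    then have "x v = 0"
      using g0[OF that(1)] that(2) by (simp add: g_def x_def)
    then have "(\<Sum>w\<in>V. of_bool ((v, w) \<in> A) * x w) = 0"
      using eigen[of v] that assms(3) by auto
    moreover have "of_bool ((v, w) \<in> A) * x w \<ge> 0" for w
      by (simp add: x_def)
    ultimately have "of_bool ((v, u) \<in> A) * x u = 0"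
      using that assms(2,3) sum_nonneg_eq_0_iff[of V "\<lambda>w. of_bool ((v, w) \<in> A) * x w"] by auto
    then show False
      using that assms(4) by (auto simp: x_def dest: symD)
  qed
qed

section \<open>Non-Hamiltonian graphs\<close>

text \<open>The vertex-list form of a Hamiltonian cycle, suited to rotating and reversing.\<close>

definition ham_cycle :: "'a set \<Rightarrow> 'a rel \<Rightarrow> 'a list \<Rightarrow> bool" where
  "ham_cycle W E xs \<longleftrightarrow> distinct xs \<and> set xs = W \<and> 3 \<le> length xs \<and>
     successively (\<lambda>x y. (x, y) \<in> E) xs \<and> (last xs, hd xs) \<in> E"

lemma ham_cycle_rotate:
  assumes "ham_cycle W E (xs @ ys)" "xs \<noteq> []" "ys \<noteq> []"
  shows "ham_cycle W E (ys @ xs)"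
  using assms by (auto simp: ham_cycle_def successively_append_iff)

lemma hamiltonian_if_ham_cycle:
  assumes "ham_cycle (pverts G) (parcs G) xs"
  shows "hamiltonian (with_proj G)"
proof -
  let ?G = "with_proj G"
  \<comment> \<open>Each vertex is paired with its successor; the last vertex of \<open>xs\<close>
    is paired with \<open>hd xs\<close>, which closes the walk.\<close>
  define walk where "walk = (\<lambda>zs. zip zs (tl zs @ [hd xs]))"
  have step: "walk (x # y # zs) = (x, y) # walk (y # zs)" "walk [x] = [(x, hd xs)]" for x y zs
    by (simp_all add: walk_def)
  \<comment> \<open>The end vertex \<open>hd xs\<close> stays fixed while the induction runs over
    \<open>zs\<close>. The start \<open>v\<close> is arbitrary, since \<open>awalk_verts\<close>
    ignores it on a nonempty walk.\<close>
  have walk: "pre_digraph.cas ?G (hd zs) (walk zs) (hd xs) \<and> set (walk zs) \<subseteq> parcs G \<and>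
      pre_digraph.awalk_verts ?G v (walk zs) = zs @ [hd xs]"
    if "zs \<noteq> []" "successively (\<lambda>x y. (x, y) \<in> parcs G) zs" "(last zs, hd xs) \<in> parcs G" for zs v
    using that
  proof (induction zs arbitrary: v rule: induct_list012)
    case (3 x y zs)
    then show ?case
      by (simp add: step pre_digraph.cas.simps pre_digraph.awalk_verts.simps)
  qed (auto simp: step pre_digraph.cas.simps pre_digraph.awalk_verts.simps)
  have xs: "distinct xs" "set xs = pverts G" "3 \<le> length xs"
    "successively (\<lambda>x y. (x, y) \<in> parcs G) xs" "(last xs, hd xs) \<in> parcs G" "xs \<noteq> []"
    using assms by (auto simp: ham_cycle_def)
  have "hd xs \<in> pverts G" using xs by (metis hd_in_set)
  moreover have "distinct (tl xs @ [hd xs])"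
    using xs(1,6) by (cases xs) auto
  moreover have "tl (xs @ [hd xs]) = tl xs @ [hd xs]" using xs(6) by simp
  moreover have len: "length (walk xs) = length xs"
    using xs(6) by (simp add: walk_def)
  moreover have "walk xs \<noteq> []" using len xs by force
  ultimately have "pre_digraph.cycle ?G (walk xs)"
    unfolding pre_digraph.cycle_def pre_digraph.awalk_def
    using walk[of xs] xs by (intro exI[of _ "hd xs"]) simp
  moreover have "fst ` set (walk xs) = pverts G"
  proof -
    have "map fst (walk xs) = xs" using xs(6) by (simp add: walk_def)
    then show ?thesis using xs(2) by (metis set_map)
  qed
  ultimately show ?thesis
    using xs(3) len by (auto simp: hamiltonian_def intro!: exI[of _ "walk xs"])
qed

text \<open>This provides a non-adjacent pair in every non-Hamiltonian graph on at least three
  vertices.\<close>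

lemma ham_cycle_complete:
  assumes "finite W" "3 \<le> card W" "\<And>u v. u \<in> W \<Longrightarrow> v \<in> W \<Longrightarrow> u \<noteq> v \<Longrightarrow> (u, v) \<in> E"
  obtains xs where "ham_cycle W E xs"
proof -
  obtain xs where xs: "distinct xs" "set xs = W"
    using finite_distinct_list[OF assms(1)] by blast
  have len: "3 \<le> length xs" using xs assms(2) distinct_card by fastforce
  have "successively (\<lambda>x y. (x, y) \<in> E) xs"
    unfolding successively_conv_nth using xs assms(3) by (auto simp: nth_eq_iff_index_eq)
  moreover have "xs \<noteq> []" using len by auto
  moreover have "last xs \<noteq> hd xs"
    using len xs(1) \<open>xs \<noteq> []\<close> by (auto simp: last_conv_nth hd_conv_nth nth_eq_iff_index_eq)
  moreover have "(last xs, hd xs) \<in> E"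
    using \<open>xs \<noteq> []\<close> \<open>last xs \<noteq> hd xs\<close> xs(2) assms(3)[of "last xs" "hd xs"] by auto
  ultimately show thesis using that xs len by (auto simp: ham_cycle_def)
qed

text \<open>The cycle must use a new arc, as it would otherwise lie in \<open>E\<close>. Rotation
  makes that arc the closing one, and opening the cycle there leaves the path.\<close>

lemma ham_path_if_ham_cycle_insert:
  assumes "ham_cycle W (E \<union> {(u, v), (v, u)}) xs" and "\<nexists>xs. ham_cycle W E xs"
  obtains p where "distinct p" "set p = W" "3 \<le> length p" "successively (\<lambda>x y. (x, y) \<in> E) p"
    "{hd p, last p} = {u, v}"
proof -
  let ?E = "E \<union> {(u, v), (v, u)}"
  have "\<exists>p. ham_cycle W ?E p \<and> (last p, hd p) \<notin> E"
  proof (cases "(last xs, hd xs) \<in> E")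
    case True
    then have "\<not> successively (\<lambda>x y. (x, y) \<in> E) xs"
      using assms by (auto simp: ham_cycle_def)
    then obtain i where i: "Suc i < length xs" "(xs ! i, xs ! Suc i) \<notin> E"
      by (auto simp: successively_conv_nth)
    let ?p = "drop (Suc i) xs @ take (Suc i) xs"
    have "ham_cycle W ?E ?p"
      using assms(1) i by (intro ham_cycle_rotate[of _ _ "take (Suc i) xs"]) auto
    moreover have "hd ?p = xs ! Suc i"
      using i by (simp add: hd_append hd_drop_conv_nth)
    moreover have "last ?p = xs ! i"
      using i by (subst last_append) (auto simp: last_conv_nth take_eq_Nil min_def)
    ultimately show ?thesis using i by metis
  qed (use assms in blast)
  then obtain p where p: "ham_cycle W ?E p" "(last p, hd p) \<notin> E" by blast
  then have ends: "{hd p, last p} = {u, v}"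
    by (auto simp: ham_cycle_def)
  have len: "3 \<le> length p" "distinct p" using p by (auto simp: ham_cycle_def)
  have "p \<noteq> []" using len by auto
  \<comment> \<open>A second use of the new edge would make the first and last positions
    consecutive, which a length of at least 3 rules out.\<close>
  have "(p ! i, p ! Suc i) \<in> E" if i: "Suc i < length p" for i
  proof (rule ccontr)
    assume "(p ! i, p ! Suc i) \<notin> E"
    moreover have "(p ! i, p ! Suc i) \<in> ?E"
      using p i by (auto simp: ham_cycle_def successively_conv_nth)
    ultimately have "{p ! i, p ! Suc i} = {p ! 0, p ! (length p - 1)}"
      using ends \<open>p \<noteq> []\<close> by (auto simp: hd_conv_nth last_conv_nth)
    then have "{i, Suc i} = {0, length p - 1}"
      using len i \<open>p \<noteq> []\<close> by (auto simp: doubleton_eq_iff nth_eq_iff_index_eq)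
    then show False using len by (auto simp: doubleton_eq_iff)
  qed
  then have "successively (\<lambda>x y. (x, y) \<in> E) p" by (simp add: successively_conv_nth)
  then show thesis using that p ends len by (auto simp: ham_cycle_def)
qed

text \<open>Ore's crossing argument: if \<open>hd p\<close> is adjacent to \<open>p ! Suc i\<close> and \<open>p ! i\<close> to \<open>last p\<close>,
  reversing the tail of the path after \<open>i\<close> closes it to a cycle.\<close>

lemma ham_path_end_degrees:
  assumes E: "E \<subseteq> W \<times> W" "sym E" "irrefl E" and no: "\<nexists>xs. ham_cycle W E xs"
    and p: "distinct p" "set p = W" "3 \<le> length p" "successively (\<lambda>x y. (x, y) \<in> E) p"
  shows "card (E `` {hd p}) + card (E `` {last p}) < card W"
proof -
  \<comment> \<open>\<open>I\<close> records the neighbours of \<open>hd p\<close> shifted back by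
    one position, \<open>J\<close> those of \<open>last p\<close>. Both lie below
    \<open>m = card W - 1\<close>, so their disjointness gives the strict bound.\<close>
  define m where "m = length p - 1"
  define I where "I = {i. i < m \<and> (hd p, p ! Suc i) \<in> E}"
  define J where "J = {i. i < m \<and> (last p, p ! i) \<in> E}"
  have ne: "p \<noteq> []" and m: "length p = Suc m" using p by (auto simp: m_def)
  have hd: "hd p = p ! 0" and last: "last p = p ! m"
    using ne m by (auto simp: hd_conv_nth last_conv_nth)
  have "E `` {hd p} \<subseteq> (\<lambda>i. p ! Suc i) ` I"
  proof
    fix w assume "w \<in> E `` {hd p}"
    then have w: "(hd p, w) \<in> E" by simp
    then obtain i where "i < length p" "w = p ! i"
      using E(1) p(2) by (metis (no_types) SigmaD2 in_set_conv_nth subsetD)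
    moreover have "i \<noteq> 0" using w E(3) hd calculation by (metis irrefl_def)
    ultimately show "w \<in> (\<lambda>i. p ! Suc i) ` I"
      using w m by (intro image_eqI[of _ _ "i - 1"]) (auto simp: I_def)
  qed
  then have 1: "card (E `` {hd p}) \<le> card I"
    by (rule surj_card_le[rotated]) (simp add: I_def)
  have "E `` {last p} \<subseteq> (\<lambda>i. p ! i) ` J"
  proof
    fix w assume "w \<in> E `` {last p}"
    then have w: "(last p, w) \<in> E" by simp
    then obtain i where "i < length p" "w = p ! i"
      using E(1) p(2) by (metis (no_types) SigmaD2 in_set_conv_nth subsetD)
    moreover have "i \<noteq> m" using w E(3) last calculation by (metis irrefl_def)
    ultimately show "w \<in> (\<lambda>i. p ! i) ` J"
      using w m by (intro image_eqI[of _ _ i]) (auto simp: J_def)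
  qed
  then have 2: "card (E `` {last p}) \<le> card J"
    by (rule surj_card_le[rotated]) (simp add: J_def)
  have "I \<inter> J = {}"
  proof (rule ccontr)
    assume "I \<inter> J \<noteq> {}"
    then obtain i where i: "i < m" "(hd p, p ! Suc i) \<in> E" "(last p, p ! i) \<in> E"
      by (auto simp: I_def J_def)
    let ?s = "take (Suc i) p" and ?t = "drop (Suc i) p"
    have st: "?s \<noteq> []" "?t \<noteq> []" using i m by auto
    have ends: "hd ?s = hd p" "last ?s = p ! i" "hd ?t = p ! Suc i" "last ?t = last p"
      using i m st by (auto simp: hd_drop_conv_nth last_conv_nth min_def)
    have "successively (\<lambda>x y. (x, y) \<in> E) (?s @ ?t)" using p(4) by simp
    then have "successively (\<lambda>x y. (x, y) \<in> E) ?s" "successively (\<lambda>x y. (x, y) \<in> E) ?t"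
      unfolding successively_append_iff by auto
    moreover have "successively (\<lambda>x y. (x, y) \<in> E) (rev ?t)"
      using calculation(2) unfolding successively_rev
      by (rule successively_mono) (use E(2) in \<open>auto dest: symD\<close>)
    ultimately have "successively (\<lambda>x y. (x, y) \<in> E) (?s @ rev ?t)"
      using st ends i E(2) by (auto simp: successively_append_iff hd_rev dest: symD)
    moreover have "(last (?s @ rev ?t), hd (?s @ rev ?t)) \<in> E"
      using st ends i E(2) by (auto simp: last_rev dest: symD)
    moreover have "set (?s @ rev ?t) = W"
      using p(2) by (metis append_take_drop_id set_append set_rev)
    moreover have "distinct (?s @ rev ?t)" "3 \<le> length (?s @ rev ?t)"
      using p by (auto simp: set_take_disj_set_drop_if_distinct)
    ultimately show False using no by (auto simp: ham_cycle_def)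
  qed
  then have "card I + card J = card (I \<union> J)"
    by (intro card_Un_disjoint[symmetric]) (auto simp: I_def J_def)
  also have "\<dots> \<le> card {..<m}" by (intro card_mono) (auto simp: I_def J_def)
  also have "\<dots> < card W" using p m distinct_card by fastforce
  finally show ?thesis using 1 2 by simp
qed

text \<open>\<open>E\<close> is taken maximal under inclusion. Adding a missing edge then creates a
  Hamiltonian cycle, hence a Hamiltonian path of \<open>E\<close> between its ends, whose degrees
  are bounded by the crossing argument.\<close>

lemma non_hamiltonian_extension:
  assumes W: "finite W" "3 \<le> card W"
    and E0: "E0 \<subseteq> W \<times> W" "sym E0" "irrefl E0" "\<nexists>xs. ham_cycle W E0 xs"
  obtains E u v where "E0 \<subseteq> E" "E \<subseteq> W \<times> W" "sym E" "irrefl E"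
    "u \<in> W" "v \<in> W" "u \<noteq> v" "(u, v) \<notin> E"
    "\<And>u v. u \<in> W \<Longrightarrow> v \<in> W \<Longrightarrow> u \<noteq> v \<Longrightarrow> (u, v) \<notin> E \<Longrightarrow>
       card (E `` {u}) + card (E `` {v}) < card W"
proof -
  define \<E> where "\<E> = {E. E \<subseteq> W \<times> W \<and> sym E \<and> irrefl E \<and> (\<nexists>xs. ham_cycle W E xs)}"
  have "finite \<E>" using W by (intro finite_subset[of \<E> "Pow (W \<times> W)"]) (auto simp: \<E>_def)
  moreover have "E0 \<in> \<E>" using E0 by (simp add: \<E>_def)
  ultimately obtain E where E: "E \<in> \<E>" "E0 \<subseteq> E" and max: "\<And>E'. E' \<in> \<E> \<Longrightarrow> E \<subseteq> E' \<Longrightarrow> E = E'"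
    using finite_has_maximal2[of \<E> E0] by metis
  have E': "E \<subseteq> W \<times> W" "sym E" "irrefl E" "\<nexists>xs. ham_cycle W E xs" using E by (auto simp: \<E>_def)
  have "card (E `` {u}) + card (E `` {v}) < card W"
    if "u \<in> W" "v \<in> W" "u \<noteq> v" "(u, v) \<notin> E" for u v
  proof -
    let ?E = "E \<union> {(u, v), (v, u)}"
    have "?E \<notin> \<E>" using max[of ?E] that by auto
    moreover have "?E \<subseteq> W \<times> W" "sym ?E" "irrefl ?E"
      using E' that by (auto simp: sym_def irrefl_def)
    ultimately obtain xs where "ham_cycle W ?E xs" by (auto simp: \<E>_def)
    then obtain p where p: "distinct p" "set p = W" "3 \<le> length p"
      "successively (\<lambda>x y. (x, y) \<in> E) p" "{hd p, last p} = {u, v}"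
      using ham_path_if_ham_cycle_insert E'(4) by metis
    then show ?thesis
      using ham_path_end_degrees[OF E' p(1-4)] by (auto simp: doubleton_eq_iff)
  qed
  moreover obtain u v where "u \<in> W" "v \<in> W" "u \<noteq> v" "(u, v) \<notin> E"
    using ham_cycle_complete[OF W, of E] E'(4) by metis
  ultimately show thesis using that E E' by metis
qed

section \<open>Complements and joins\<close>

lemma out_degree_with_proj: "out_degree (with_proj G) v = card (parcs G `` {v})"
proof -
  have "out_arcs (with_proj G) v = Pair v ` (parcs G `` {v})"
    by (auto simp: out_arcs_def)
  then show ?thesis
    by (simp add: out_degree_def card_image inj_on_def)
qed

lemma pair_graphI:
  assumes "finite V" "R \<subseteq> V \<times> V" "sym R" "irrefl R"
  shows "pair_graph \<lparr>pverts = V, parcs = R\<rparr>"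
  using assms finite_subset[OF assms(2)] by unfold_locales (auto simp: irrefl_def symmetric_def)

lemma pair_graphD:
  assumes "pair_graph G"
  shows "finite (pverts G)" "parcs G \<subseteq> pverts G \<times> pverts G" "sym (parcs G)" "irrefl (parcs G)"
proof -
  interpret pair_graph G by fact
  show "finite (pverts G)" by (rule pair_finite_verts)
  show "parcs G \<subseteq> pverts G \<times> pverts G"
    using arc_fst_in_verts arc_snd_in_verts by fastforce
  show "sym (parcs G)" using pair_sym_arcs by (simp add: symmetric_def)
  show "irrefl (parcs G)" using pair_no_loops by (fastforce simp: irrefl_def)
qed

lemma pair_graph_complement:
  assumes "pair_graph G"
  shows "pair_graph (graph_complement G)"
  unfolding graph_complement_def using pair_graphD[OF assms]
  by (intro pair_graphI) (auto simp: sym_def irrefl_def)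

lemma card_complement_neighbours:
  assumes "pair_graph G" "u \<in> pverts G"
  shows "card (parcs (graph_complement G) `` {u}) + card (parcs G `` {u}) + 1 = graph_order G"
proof -
  note G = pair_graphD[OF assms(1)]
  let ?A = "parcs (graph_complement G) `` {u}" and ?B = "parcs G `` {u}"
  have sub: "?A \<subseteq> pverts G" "?B \<subseteq> pverts G"
    using G(2) by (auto simp: graph_complement_def)
  have "pverts G = insert u (?A \<union> ?B)" "?A \<inter> ?B = {}" "u \<notin> ?A \<union> ?B"
    using G(2,4) assms(2) by (auto simp: graph_complement_def irrefl_def)
  moreover have "finite ?A" "finite ?B"
    using sub G(1) finite_subset by blast+
  ultimately show ?thesis
    by (simp add: card_Un_disjoint)
qed

text \<open>No edge of the complement leaves \<open>S\<close>, so in \<open>G\<close> every vertex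
  of \<open>S\<close> is adjacent to every vertex outside \<open>S\<close>.\<close>

lemma graph_join_complement_component:
  assumes "pair_graph G" "S \<subseteq> pverts G" "F \<subseteq> S \<times> S"
    and "\<And>u v. u \<in> S \<Longrightarrow> (u, v) \<in> parcs (graph_complement G) \<longleftrightarrow> (u, v) \<in> F"
  shows "G = graph_join (graph_complement \<lparr>pverts = S, parcs = F\<rparr>)
    \<lparr>pverts = pverts G - S, parcs = parcs G \<inter> (pverts G - S) \<times> (pverts G - S)\<rparr>"
proof -
  note G = pair_graphD[OF assms(1)]
  have iff: "(u, v) \<in> parcs G \<longleftrightarrow> u \<noteq> v \<and> (u, v) \<notin> F" if "u \<in> S" "v \<in> pverts G" for u v
    using assms(2,4) that G(4) by (fastforce simp: graph_complement_def irrefl_def)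
  have iff': "(u, v) \<in> parcs G \<longleftrightarrow> (v, u) \<in> parcs G" for u v
    using G(3) by (auto dest: symD)
  have "(u, v) \<in> parcs G \<longleftrightarrow> (u, v) \<in> parcs (graph_join (graph_complement \<lparr>pverts = S, parcs = F\<rparr>)
    \<lparr>pverts = pverts G - S, parcs = parcs G \<inter> (pverts G - S) \<times> (pverts G - S)\<rparr>)" for u v
  proof (cases "u \<in> pverts G \<and> v \<in> pverts G")
    case True
    then show ?thesis
      using iff[of u v] iff[of v u] iff'[of u v] assms(2,3)
      by (cases "u \<in> S"; cases "v \<in> S") (auto simp: graph_join_def graph_complement_def)
  next
    case False
    then show ?thesis
      using G(2) assms(2) by (auto simp: graph_join_def graph_complement_def)
  qed
  then have "parcs G = parcs (graph_join (graph_complement \<lparr>pverts = S, parcs = F\<rparr>)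
    \<lparr>pverts = pverts G - S, parcs = parcs G \<inter> (pverts G - S) \<times> (pverts G - S)\<rparr>)"
    by auto
  moreover have "pverts G = S \<union> (pverts G - S)" using assms(2) by blast
  ultimately show ?thesis
    by (intro pair_pre_digraph.equality) (simp_all add: graph_join_def graph_complement_def)
qed

text \<open>For \<open>d\<close> between \<open>a\<close> and \<open>b\<close> the product \<open>d * (a + b - d)\<close> exceeds \<open>a * b\<close> by
  \<open>(d - a) * (b - d)\<close>.\<close>

lemma degree_product_ge:
  fixes a b d e :: nat
  assumes "a + b \<le> d + e" "d \<le> b" "e \<le> b"
  shows "a * b \<le> d * e" and "0 < a \<Longrightarrow> d * e = a * b \<Longrightarrow> d = a \<and> e = b \<or> d = b \<and> e = a"
proof -
  have "a \<le> d" using assms by simp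
  \<comment> \<open>With \<open>d - a\<close>, \<open>b - d\<close> and the surplus \<open>l\<close>
    of the degree sum as variables, \<open>d * e - a * b\<close> becomes a sum of nonnegative
    terms.\<close>
  then obtain i j where d: "d = a + i" and b: "b = d + j"
    using assms(2) le_Suc_ex by metis
  have "a + j \<le> e" using assms(1) d b by simp
  then obtain l where e: "e = a + j + l" using le_Suc_ex by blast
  have "d * e = a * b + i * j + d * l"
    by (simp add: d b e algebra_simps)
  then show "a * b \<le> d * e" by simp
  assume "0 < a" "d * e = a * b"
  then have "i * j = 0" "l = 0" using \<open>d * e = a * b + i * j + d * l\<close> d by auto
  then show "d = a \<and> e = b \<or> d = b \<and> e = a" using d b e by auto
qed

section \<open>From a non-Hamiltonian induced subgraph to the extremal families\<close>

theorem theorem3p5: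
  fixes G :: "'a pair_pre_digraph" and s k n :: nat
  assumes "k \<ge> s + 1" and "n \<ge> 2 * k + 1"
    and "pair_graph G" and "Digraph_Component.connected (with_proj G)"
    and "graph_order G = n" and "min_degree G \<ge> k"
    and "graph_spectral_radius (graph_complement G) \<le> sqrt ((real k - real s) * (real n - real k - 1))"
  shows "s_hamiltonian s G \<or> G \<in> EP n k \<or> G \<in> ES n k s"
proof (rule disjCI)
  assume "\<not> (G \<in> EP n k \<or> G \<in> ES n k s)"
  then have not_EP: "G \<notin> EP n k" and not_ES: "G \<notin> ES n k s" by auto
  show "s_hamiltonian s G"
  proof (rule ccontr)
    assume "\<not> s_hamiltonian s G"
    then obtain X where X: "X \<subseteq> pverts G" "card X \<le> s"
      and not_ham: "\<not> hamiltonian (with_proj G \<restriction> (pverts G - X))"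
      by (auto simp: s_hamiltonian_def)
    note G = pair_graphD[OF assms(3)]
    define V where "V = pverts G"
    define A where "A = parcs (graph_complement G)"
    define W where "W = V - X"
    define E0 where "E0 = parcs G \<inter> W \<times> W"
    define a b where "a = k - s" and "b = n - k - 1"
    have ab: "0 < a" "0 < b" "a + b = n - s - 1" "a \<le> b"
      using assms(1,2) by (auto simp: a_def b_def)
    have V: "finite V" "card V = n"
      using G(1) assms(5) by (auto simp: V_def)
    have W: "finite W" "W \<subseteq> V" using V by (auto simp: W_def)
    have "card W = n - card X"
      unfolding W_def using X V by (metis V_def card_Diff_subset finite_subset)
    then have card_W: "n - s \<le> card W" "3 \<le> card W" using X(2) assms(1,2) by auto
    have "with_proj G \<restriction> W = with_proj \<lparr>pverts = W, parcs = E0\<rparr>"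
      by (auto simp: induce_subgraph_def with_proj_def E0_def)
    then have "\<nexists>xs. ham_cycle W E0 xs"
      using not_ham hamiltonian_if_ham_cycle[of "\<lparr>pverts = W, parcs = E0\<rparr>"]
      by (auto simp: W_def V_def)
    moreover have "E0 \<subseteq> W \<times> W" "sym E0" "irrefl E0"
      using G(3,4) by (auto simp: E0_def sym_def irrefl_def)
    ultimately obtain E u0 v0 where E: "E0 \<subseteq> E" "E \<subseteq> W \<times> W" "sym E" "irrefl E"
      and uv0: "u0 \<in> W" "v0 \<in> W" "u0 \<noteq> v0" "(u0, v0) \<notin> E"
      and ore: "\<And>u v. u \<in> W \<Longrightarrow> v \<in> W \<Longrightarrow> u \<noteq> v \<Longrightarrow> (u, v) \<notin> E \<Longrightarrow>
         card (E `` {u}) + card (E `` {v}) < card W"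
      using non_hamiltonian_extension[OF W(1) card_W(2)] by metis
    define H where "H = \<lparr>pverts = W, parcs = E\<rparr>"
    have H: "pair_graph H" unfolding H_def using W E by (intro pair_graphI)
    define F where "F = parcs (graph_complement H)"
    have F_iff: "(u, v) \<in> F \<longleftrightarrow> u \<in> W \<and> v \<in> W \<and> u \<noteq> v \<and> (u, v) \<notin> E" for u v
      by (auto simp: F_def graph_complement_def H_def)
    have F: "F \<subseteq> A" "sym F" "irrefl F" "F \<subseteq> W \<times> W"
      using E W(2) by (auto simp: F_iff A_def graph_complement_def E0_def V_def sym_def irrefl_def)
    define d where "d = (\<lambda>u. card (F `` {u}))"
    have d_E: "d u + card (E `` {u}) + 1 = card W" if "u \<in> W" for u
      using card_complement_neighbours[OF H, of u] that by (simp add: d_def F_def H_def)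
    have d_le: "d u \<le> b" if "u \<in> W" for u
    \<comment> \<open>Since \<open>F\<close> lies in \<open>A\<close>, the degree \<open>d u\<close>
      is at most \<open>n - 1\<close> minus the degree of \<open>u\<close> in
      \<open>G\<close>.\<close>
    proof -
      have "u \<in> V" using that W by blast
      then have "min_degree G \<le> out_degree (with_proj G) u"
        unfolding min_degree_def using V by (intro Min_le) (auto simp: V_def)
      then have "k \<le> card (parcs G `` {u})" using assms(6) by (simp add: out_degree_with_proj)
      moreover have "card (A `` {u}) + card (parcs G `` {u}) + 1 = n"
        using card_complement_neighbours[OF assms(3), of u] \<open>u \<in> V\<close> assms(5)
        by (simp add: A_def V_def)
      moreover have "d u \<le> card (A `` {u})"
        unfolding d_def using F(1) V by (intro card_mono) (auto simp: A_def graph_complement_def V_def)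
      ultimately show ?thesis by (simp add: b_def)
    qed
    \<comment> \<open>Passing to the complement within \<open>W\<close>, the strict Ore bound gives
      \<open>d u + d v \<ge> card W - 1 \<ge> n - s - 1\<close>, which is
      \<open>a + b\<close>.\<close>
    have edge: "a + b \<le> d u + d v" "d u \<le> b" "d v \<le> b" if "(u, v) \<in> F" for u v
    proof -
      have "card (E `` {u}) + card (E `` {v}) < card W" "u \<in> W" "v \<in> W"
        using that ore by (auto simp: F_iff)
      then show "a + b \<le> d u + d v" "d u \<le> b" "d v \<le> b"
        using d_E[of u] d_E[of v] d_le card_W ab(3) by auto
    qed
    define c where "c = sqrt (real (a * b))"
    have "(real k - real s) * (real n - real k - 1) = real (a * b)"
      using assms(1,2) by (simp add: a_def b_def of_nat_diff)
    then have radius: "graph_spectral_radius (graph_complement G) \<le> c"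
      using assms(7) by (simp add: c_def)
    have compl: "pverts (graph_complement G) = V" by (simp add: graph_complement_def V_def)
    note AG = pair_graphD[OF pair_graph_complement[OF assms(3)], folded A_def, unfolded compl]
    have bound: "quadratic_form V (\<lambda>u v. of_bool ((u, v) \<in> A)) y \<le> c * (\<Sum>v\<in>V. (y v)\<^sup>2)" for y
    proof -
      have "quadratic_form V (\<lambda>u v. of_bool ((u, v) \<in> A)) y
          \<le> graph_spectral_radius (graph_complement G) * (\<Sum>v\<in>V. (y v)\<^sup>2)"
        using quadratic_form_le_spectral_radius[of "graph_complement G" y] AG
        by (simp add: compl A_def)
      also have "\<dots> \<le> c * (\<Sum>v\<in>V. (y v)\<^sup>2)"
        using radius by (intro mult_right_mono sum_nonneg) auto
      finally show ?thesis .
    qed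
    have c2: "c\<^sup>2 = real (a * b)" by (simp add: c_def)
    have "c \<ge> 0" by (simp add: c_def)
    have prod: "c\<^sup>2 \<le> real (card (F `` {u}) * card (F `` {v}))" if "(u, v) \<in> F" for u v
      using degree_product_ge(1)[OF edge[OF that]] unfolding c2 d_def of_nat_le_iff .
    \<comment> \<open>The spectral hypothesis supplies the upper bound and the degree product the
      lower one, so both equality conclusions apply.\<close>
    note rigid = quadratic_form_edge_degrees_equality[OF V(1) AG(2,3) F(1) \<open>c \<ge> 0\<close> bound prod,
        unfolded c2 of_nat_eq_iff]
    have tight: "d u = a \<and> d v = b \<or> d u = b \<and> d v = a" if "(u, v) \<in> F" for u v
      using degree_product_ge(2)[OF edge[OF that] ab(1)] rigid(1)[OF _ that] by (simp add: d_def)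
    define S where "S = Domain F"
    have "(u0, v0) \<in> F" using uv0 by (simp add: F_iff)
    then have S: "S \<subseteq> V" "F \<subseteq> S \<times> S" "S \<noteq> {}"
      using F(2,4) W(2) by (auto simp: S_def dest: symD)
    have "finite S" using S(1) V(1) by (rule finite_subset)
    have d_S: "d u = a \<or> d u = b" if "u \<in> S" for u
      using that tight by (auto simp: S_def)
    \<comment> \<open>Degrees on \<open>S\<close> are \<open>a\<close> or \<open>b\<close>, both
      positive, so every arc of \<open>A\<close> starting in \<open>S\<close> is in
      \<open>F\<close>.\<close>
    have "(u, v) \<in> A \<longleftrightarrow> (u, v) \<in> F" if "u \<in> S" for u v
      using rigid(2)[of u v] d_S[OF that] ab F(1) by (auto simp: d_def)
    define G1 where "G1 = \<lparr>pverts = S, parcs = F\<rparr>"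
    define G2 where "G2 = \<lparr>pverts = V - S, parcs = parcs G \<inter> (V - S) \<times> (V - S)\<rparr>"
    have join: "G = graph_join (graph_complement G1) G2"
      unfolding G1_def G2_def V_def
      using S \<open>\<And>u v. u \<in> S \<Longrightarrow> (u, v) \<in> A \<longleftrightarrow> (u, v) \<in> F\<close>
      by (intro graph_join_complement_component assms(3)) (auto simp: V_def A_def)
    have G1: "pair_graph G1" unfolding G1_def using S \<open>finite S\<close> F by (intro pair_graphI)
    have G2: "pair_graph G2"
      unfolding G2_def using V G(3,4) by (intro pair_graphI) (auto simp: sym_def irrefl_def)
    have deg: "out_degree (with_proj G1) u = d u" for u
      by (simp add: out_degree_with_proj G1_def d_def)
    have card_S: "card S \<le> n" "card (V - S) = n - card S"
      using S \<open>finite S\<close> V by (auto simp: card_Diff_subset intro: card_mono)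
    show False
    proof (cases "a = b")
      \<comment> \<open>Since \<open>b \<ge> k \<ge> a\<close>, equality forces \<open>s = 0\<close>
        and \<open>n = 2 * k + 1\<close>. Then \<open>F\<close> is \<open>k\<close>-regular on
        \<open>S\<close>, and the complement of \<open>G1\<close> is regular of degree
        \<open>r\<close>.\<close>
      case True
      then have n: "a = k" "b = k" "n = 2 * k + 1"
        using assms(1,2) by (auto simp: a_def b_def)
      define r where "r = card S - 1 - k"
      have regular: "card (parcs (graph_complement G1) `` {u}) + k + 1 = card S" if "u \<in> S" for u
        using card_complement_neighbours[OF G1, of u] deg[of u] d_S[OF that] that n
        by (simp add: out_degree_with_proj) (simp add: G1_def)
      obtain u where "u \<in> S" using S by blast
      then have "card S = k + 1 + r" using regular[of u] by (simp add: r_def)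
      have "G \<in> EP n k"
        unfolding EP_def mem_Collect_eq
      proof (intro conjI exI)
        \<comment> \<open>The vertices outside \<open>S\<close> number
          \<open>2 * k + 1 - (k + 1 + r) = k - r\<close>.\<close>
        let ?K = "\<lparr>pverts = V - S, parcs = {(u, v). (u, v) \<in> (V - S) \<times> (V - S) \<and> u \<noteq> v}\<rparr>"
        show "graph_order G = n" by fact
        show "r \<le> k" using \<open>card S = k + 1 + r\<close> card_S n by simp
        show "pair_graph (graph_complement G1)" by (rule pair_graph_complement[OF G1])
        show "pair_graph G2" by fact
        show "pverts (graph_complement G1) \<inter> pverts G2 = {}"
          by (auto simp: graph_complement_def G1_def G2_def)
        show "regular_graph r (graph_complement G1)"
          unfolding regular_graph_def out_degree_with_proj
        proof
          fix u assume "u \<in> pverts (graph_complement G1)"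
          then have "u \<in> S" by (simp add: graph_complement_def G1_def)
          then show "card (parcs (graph_complement G1) `` {u}) = r"
            using regular[of u] \<open>card S = k + 1 + r\<close> by simp
        qed
        show "int (graph_order (graph_complement G1)) = int n - int k + int r"
          using \<open>card S = k + 1 + r\<close> n by (simp add: graph_complement_def G1_def)
        show "complete_digraph (k - r) (with_proj ?K)"
          unfolding complete_digraph_pair_def
          using V card_S \<open>card S = k + 1 + r\<close> n by simp
        show "spanning (with_proj G2) (with_proj ?K)"
          using G(4)
          by (auto simp: spanning_def subgraph_def compatible_def wf_digraph_def G2_def irrefl_def)
        show "G = graph_join (graph_complement G1) G2" by fact
      qed
      then show False using not_EP by simp
    next
      case False
      \<comment> \<open>The classes are disjoint because \<open>a\<close> and \<open>b\<close>
        differ, and \<open>tight\<close> sends every arc of \<open>F\<close> from one to the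
        other.\<close>
      define X Y where "X = {u \<in> S. d u = a}" and "Y = {u \<in> S. d u = b}"
      have "bipartition G1 X Y"
        using d_S tight S(2) False by (fastforce simp: bipartition_def X_def Y_def G1_def)
      then have semi: "semi_regular_bipartite G1 X Y"
        by (simp add: semi_regular_bipartite_def deg X_def Y_def)
      have "G \<in> ES n k s"
        unfolding ES_def mem_Collect_eq
      proof (intro conjI exI)
        \<comment> \<open>The order condition on \<open>G1\<close> determines this integer.\<close>
        let ?r = "int (card S) - int n + int s + 1"
        show "graph_order G = n" by fact
        show "int s + 1 - ?r \<ge> 0" using card_S by simp
        show "pverts G1 \<inter> pverts G2 = {}" "pverts G1 \<noteq> {}"
          using S by (auto simp: G1_def G2_def)
        show "int (graph_order G1) = int n - int s - 1 + ?r" by (simp add: G1_def)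
        show "\<forall>u\<in>X. int (out_degree (with_proj G1) u) = int k - int s"
          using assms(1) by (simp add: deg X_def a_def)
        show "\<forall>v\<in>Y. int (out_degree (with_proj G1) v) = int n - int k - 1"
          using assms(2) by (simp add: deg Y_def b_def)
        show "int (graph_order G2) = int s + 1 - ?r" using card_S by (simp add: G2_def)
      qed (fact G1 G2 semi join)+
      then show False using not_ES by simp
    qed
  qed
qed

end
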